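(* Let $f(z)=\prod_{j=1}^d(z-\zeta_j)$ be a monic complex polynomial of degree $d\ge1$ with distinct roots satisfying $|\zeta_j|\le1$. For $r>0$ let $a_r(t)=\operatorname{Arg} f(re^{2\pi i t})$, $t\in[0,1)$. If $r>1$, then for all $t\in[0,1)$, $$2\pi d\cdot\frac{r}{r+1}\le a_r'(t)\le 2\pi d\cdot\frac{r}{r-1}.$$
   Context: The derivative $a_r'(t)$ is computed using a locally continuous (hence smooth) branch of the argument, which exists because $f\neq0$ on $|z|=r>1$; the jumps by $2\pi$ of a fixed principal branch are disregarded. *)

theory Defs
  imports "HOL-Complex_Analysis.Complex_Analysis"
begin

(* The loop t |-> f(r e^{2 pi i t}), 1-periodic and defined for every real t, so that
   derivatives at t = 0 are two-sided. *)
definition circle_value :: "complex poly \<Rightarrow> real \<Rightarrow> real \<Rightarrow> complex" where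
  "circle_value f r t = poly f (of_real r * exp (2 * of_real pi * \<i> * of_real t))"

(* Near t, the function a is a continuous choice of argument of g; values of a are not
   confined to the range of the principal branch Arg. Nonvanishing of g is required
   because every real number satisfies is_Arg 0. *)
definition arg_branch_at :: "(real \<Rightarrow> complex) \<Rightarrow> real \<Rightarrow> (real \<Rightarrow> real) \<Rightarrow> bool" where
  "arg_branch_at g t a \<longleftrightarrow>
     (\<exists>U. open U \<and> t \<in> U \<and> continuous_on U a \<and> (\<forall>s\<in>U. g s \<noteq> 0 \<and> is_Arg (g s) (a s)))"

end

theory Submission
  imports Defs
begin

text \<open>
  A continuous argument of a differentiable curve g has derivative Im (g' / g).
  On the circle w = r e^{2 pi i t} the logarithmic derivative of f turns this into
  2 pi times the sum of the Re (w / (w - \<zeta> j)), and each summand lies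
  between r / (r + 1) and r / (r - 1).
\<close>

lemma is_Arg_divide:
  assumes "is_Arg z a" "is_Arg w b"
  shows "is_Arg (z / w) (a - b)"
proof -
  have "z / w = (of_real (norm z) * exp (\<i> * of_real a)) / (of_real (norm w) * exp (\<i> * of_real b))"
    using assms unfolding is_Arg_def by metis
  also have "\<dots> = of_real (norm (z / w)) * exp (\<i> * of_real (a - b))"
    by (simp add: norm_divide exp_diff right_diff_distrib)
  finally show ?thesis
    unfolding is_Arg_def .
qed

lemma is_Arg_mult:
  assumes "is_Arg z a" "is_Arg w b"
  shows "is_Arg (z * w) (a + b)"
proof -
  have "z * w = (of_real (norm z) * exp (\<i> * of_real a)) * (of_real (norm w) * exp (\<i> * of_real b))"
    using assms unfolding is_Arg_def by metis
  also have "\<dots> = of_real (norm (z * w)) * exp (\<i> * of_real (a + b))"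
    by (simp add: norm_mult exp_add distrib_left)
  finally show ?thesis
    unfolding is_Arg_def .
qed

text \<open>Division by \<open>g t\<close> moves the base value to 1, away from the branch cut, so
  the principal \<open>Arg\<close> of the quotient is continuous near \<open>t\<close>; adding
  \<open>Arg (g t)\<close> turns it into an argument of \<open>g\<close>. This keeps the bounds
  quantified over all branches from being vacuous.\<close>

lemma arg_branch_at_exists:
  assumes cont: "continuous_on UNIV g" and nz: "g t \<noteq> 0"
  shows "\<exists>a. arg_branch_at g t a"
proof -
  define U where "U = (\<lambda>s. g s / g t) -` (- \<real>\<^sub>\<le>\<^sub>0)"
  define a where "a = (\<lambda>s. Arg (g s / g t) + Arg (g t))"
  have cont_quot: "continuous_on S (\<lambda>s. g s / g t)" for S
    using nz by (intro continuous_intros continuous_on_subset[OF cont]) auto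
  have "open U"
    unfolding U_def by (intro open_vimage cont_quot) auto
  moreover have "t \<in> U"
    using nz by (simp add: U_def)
  moreover have "continuous_on U a"
    unfolding a_def by (intro continuous_intros cont_quot) (auto simp: U_def)
  moreover have "g s \<noteq> 0 \<and> is_Arg (g s) (a s)" if "s \<in> U" for s
  proof
    show "g s \<noteq> 0"
      using that by (auto simp: U_def)
    then show "is_Arg (g s) (a s)"
      using is_Arg_mult[of "g s / g t" "Arg (g s / g t)" "g t" "Arg (g t)"] nz
      by (simp add: a_def is_Arg_Arg)
  qed
  ultimately show ?thesis
    unfolding arg_branch_at_def by blast
qed

text \<open>Continuity forces every branch to coincide near \<open>t\<close> with
  \<open>a t + Im (Ln (g s / g t))\<close>, since two arguments of one number that are close enough
  must agree. The derivative can then be read off from that of \<open>Ln\<close> at 1.\<close>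

lemma arg_branch_at_has_real_derivative:
  assumes branch: "arg_branch_at g t a"
    and g': "(g has_vector_derivative g') (at t)"
  shows "(a has_real_derivative Im (g' / g t)) (at t)"
proof -
  obtain U where U: "open U" "t \<in> U" "continuous_on U a"
    and arg: "\<And>s. s \<in> U \<Longrightarrow> g s \<noteq> 0 \<and> is_Arg (g s) (a s)"
    using branch unfolding arg_branch_at_def by blast
  have nz: "g t \<noteq> 0"
    using arg U by blast
  have "((\<lambda>s. g s / g t) has_vector_derivative g' / g t) (at t)"
    using g' by (rule has_vector_derivative_divide)
  moreover have "(Ln has_field_derivative 1) (at (g t / g t))"
    using has_field_derivative_Ln[of 1] nz by simp
  ultimately have "((\<lambda>s. Ln (g s / g t)) has_vector_derivative (g' / g t * 1)) (at t)"
    by (rule field_vector_diff_chain_at[unfolded o_def])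
  then have Ln': "((\<lambda>s. Im (Ln (g s / g t))) has_real_derivative Im (g' / g t)) (at t)"
    using bounded_linear.has_vector_derivative[OF bounded_linear_Im]
    by (fastforce simp: has_real_derivative_iff_has_vector_derivative)
  have "(a \<longlongrightarrow> a t) (at t)"
    using U by (metis continuous_on_eq_continuous_at isCont_def)
  \<comment> \<open>The bound \<open>pi\<close> places \<open>a s - a t\<close> inside the range of
    the principal argument, so that \<open>Arg_unique\<close> excludes a jump by a multiple of 2
    pi.\<close>
  then have "eventually (\<lambda>s. dist (a s) (a t) < pi) (at t)"
    by (rule tendstoD) simp
  then have "eventually (\<lambda>s. dist (a s) (a t) < pi) (nhds t)"
    by (simp add: eventually_nhds_conv_at)
  moreover have "eventually (\<lambda>s. s \<in> U) (nhds t)"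
    using U by (simp add: eventually_nhds_in_open)
  ultimately have near: "eventually (\<lambda>s. a s = a t + Im (Ln (g s / g t))) (nhds t)"
  proof eventually_elim
    case (elim s)
    have "is_Arg (g s / g t) (a s - a t)"
      using arg elim U by (blast intro: is_Arg_divide)
    then have "g s / g t = of_real (norm (g s / g t)) * exp (\<i> * of_real (a s - a t))"
      unfolding is_Arg_def .
    moreover have "0 < norm (g s / g t)" and "g s / g t \<noteq> 0"
      using arg[OF elim(2)] nz by auto
    ultimately have "Arg (g s / g t) = a s - a t"
      using elim(1) Arg_unique[of "norm (g s / g t)" "a s - a t" "g s / g t"]
      by (auto simp: dist_real_def abs_less_iff)
    then show ?case
      using \<open>g s / g t \<noteq> 0\<close> by (simp add: Arg_eq_Im_Ln)
  qed
  have "((\<lambda>s. a t + Im (Ln (g s / g t))) has_real_derivative Im (g' / g t)) (at t)"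
    using DERIV_add[OF DERIV_const Ln'] by simp
  then show ?thesis
    using DERIV_cong_ev[OF refl near refl] by blast
qed

text \<open>The logarithmic derivative of a product of linear factors, with the denominator cleared.
  It follows from the product rule by induction on the index set.\<close>

lemma poly_pderiv_prod_linear:
  fixes c :: "'b \<Rightarrow> 'a :: field"
  assumes "finite A" "\<And>j. j \<in> A \<Longrightarrow> x \<noteq> c j"
  shows "poly (pderiv (\<Prod>j\<in>A. [:- c j, 1:])) x =
    poly (\<Prod>j\<in>A. [:- c j, 1:]) x * (\<Sum>j\<in>A. 1 / (x - c j))"
  using assms
proof (induction A)
  case (insert i A)
  let ?P = "\<Prod>j\<in>A. [:- c j, 1:]"
  have "x - c i \<noteq> 0"
    using insert by simp
  have "poly (pderiv (\<Prod>j\<in>insert i A. [:- c j, 1:])) x = poly ([:- c i, 1:] * pderiv ?P + ?P) x"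
    by (simp only: prod.insert[OF insert.hyps] pderiv_mult) (simp add: pderiv_pCons)
  also have "\<dots> = (x - c i) * (poly ?P x * (\<Sum>j\<in>A. 1 / (x - c j))) + poly ?P x"
    using insert by (simp only: poly_add poly_mult) simp
  also have "\<dots> = (x - c i) * poly ?P x * (1 / (x - c i) + (\<Sum>j\<in>A. 1 / (x - c j)))"
    using \<open>x - c i \<noteq> 0\<close> by (simp add: distrib_left)
  also have "\<dots> = poly (\<Prod>j\<in>insert i A. [:- c j, 1:]) x * (\<Sum>j\<in>insert i A. 1 / (x - c j))"
    by (simp only: prod.insert[OF insert.hyps] sum.insert[OF insert.hyps] poly_mult) simp
  finally show ?case .
qed simp

lemma circle_value_has_vector_derivative:
  "(circle_value f r has_vector_derivative
      2 * of_real pi * \<i> * (of_real r * exp (2 * of_real pi * \<i> * of_real t)) *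
      poly (pderiv f) (of_real r * exp (2 * of_real pi * \<i> * of_real t))) (at t)"
proof -
  \<comment> \<open>The parameter is made complex so that the holomorphic chain rule applies;
    restriction to real arguments follows.\<close>
  let ?w = "\<lambda>z. of_real r * exp (2 * of_real pi * \<i> * z)"
  have "((\<lambda>z. poly f (?w z)) has_field_derivative
      poly (pderiv f) (?w (of_real t)) * (2 * of_real pi * \<i> * ?w (of_real t))) (at (of_real t))"
    by (rule DERIV_chain2[OF poly_DERIV]) (auto intro!: derivative_eq_intros)
  then have "((\<lambda>s. poly f (?w (of_real s))) has_vector_derivative
      poly (pderiv f) (?w (of_real t)) * (2 * of_real pi * \<i> * ?w (of_real t))) (at t)"
    by (rule has_vector_derivative_real_field)
  then show ?thesis
    by (simp add: circle_value_def[abs_def] mult.commute)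
qed

text \<open>The upper bound is Re \<le> norm with the reverse triangle inequality; the lower one is
  a polynomial inequality after clearing denominators. Equality occurs at \<open>z = w / r\<close>
  above and at \<open>z = - w / r\<close> below.\<close>

lemma Re_divide_diff_bounds:
  fixes w z :: complex
  assumes z: "norm z \<le> 1" and w: "norm w = r" and r: "r > 1"
  shows "r / (r + 1) \<le> Re (w / (w - z))" "Re (w / (w - z)) \<le> r / (r - 1)"
proof -
  have diff: "r - 1 \<le> norm (w - z)"
    using norm_triangle_ineq2[of w z] z w by linarith
  have "Re (w / (w - z)) \<le> norm w / norm (w - z)"
    using complex_Re_le_cmod[of "w / (w - z)"] by (simp add: norm_divide)
  also have "\<dots> \<le> r / (r - 1)"
    unfolding w using diff r by (intro divide_left_mono mult_pos_pos) auto
  finally show "Re (w / (w - z)) \<le> r / (r - 1)" .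
  define x where "x = w \<bullet> z"
  have "\<bar>x\<bar> \<le> norm w * norm z"
    unfolding x_def by (rule Cauchy_Schwarz_ineq2)
  also have "\<dots> \<le> r * 1"
    unfolding w using z r by (intro mult_left_mono) auto
  \<comment> \<open>In \<open>key\<close>, the right side minus the left side equals
    \<open>(r + x) * (r - 1) + r * (1 - (norm z)\<^sup>2)\<close>. Both summands are nonnegative:
    the first because \<bar>x\<bar> \<le> r, the second because \<open>norm z\<close> is at most
    1.\<close>
  finally have "(r + x) * (r - 1) \<ge> 0"
    using r by (intro mult_nonneg_nonneg) auto
  moreover have "r * (norm z)\<^sup>2 \<le> r * 1"
    using z r by (intro mult_left_mono) (auto simp: power_le_one)
  ultimately have key: "r * (r\<^sup>2 - 2 * x + (norm z)\<^sup>2) \<le> (r\<^sup>2 - x) * (r + 1)"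
    by (simp add: algebra_simps power2_eq_square)
  have norm_diff: "(norm (w - z))\<^sup>2 = r\<^sup>2 - 2 * x + (norm z)\<^sup>2"
    unfolding x_def by (simp add: power2_norm_eq_inner inner_diff inner_commute w[symmetric])
  have "w \<bullet> (w - z) = r\<^sup>2 - x"
    unfolding x_def by (simp add: power2_norm_eq_inner inner_diff_right w[symmetric])
  then have Re_eq: "Re (w / (w - z)) = (r\<^sup>2 - x) / (norm (w - z))\<^sup>2"
    by (simp add: Re_divide inner_complex_def cmod_power2)
  have "(norm (w - z))\<^sup>2 > 0"
    using diff r by (intro zero_less_power) linarith
  with key show "r / (r + 1) \<le> Re (w / (w - z))"
    unfolding Re_eq norm_diff using r by (simp add: divide_le_eq pos_le_divide_eq mult.commute)
qed

theorem lemma5p1: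
  fixes f :: "complex poly" and d :: nat and \<zeta> :: "nat \<Rightarrow> complex" and r :: real
  assumes "d \<ge> 1"
    and "f = (\<Prod>j=1..d. [:- \<zeta> j, 1:])"
    and "inj_on \<zeta> {1..d}"
    and "\<And>j. j \<in> {1..d} \<Longrightarrow> norm (\<zeta> j) \<le> 1"
    and "r > 1"
  shows "\<forall>t\<in>{0..<1}.
    (\<exists>a. arg_branch_at (circle_value f r) t a) \<and>
    (\<forall>a. arg_branch_at (circle_value f r) t a \<longrightarrow>
       a differentiable (at t) \<and>
       2 * pi * real d * (r / (r + 1)) \<le> deriv a t \<and>
       deriv a t \<le> 2 * pi * real d * (r / (r - 1)))"
proof (intro ballI conjI allI impI)
  fix t :: real
  define w where "w = of_real r * exp (2 * of_real pi * \<i> * of_real t)"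
  have norm_w: "norm w = r"
    using \<open>r > 1\<close> by (simp add: w_def norm_mult)
  \<comment> \<open>The circle of radius r > 1 lies outside the closed unit disc, which contains all
    roots.\<close>
  have w_ne: "w \<noteq> \<zeta> j" if "j \<in> {1..d}" for j
    using assms(4)[OF that] norm_w \<open>r > 1\<close> by auto
  have val: "circle_value f r t = poly f w"
    by (simp add: circle_value_def w_def)
  have nz: "poly f w \<noteq> 0"
    using w_ne by (simp add: assms(2) poly_prod)
  show "\<exists>a. arg_branch_at (circle_value f r) t a"
    using nz val
    by (intro arg_branch_at_exists) (auto simp: circle_value_def[abs_def] intro!: continuous_intros)
  fix a assume a: "arg_branch_at (circle_value f r) t a"
  let ?S = "\<Sum>j=1..d. Re (w / (w - \<zeta> j))"
  have "poly (pderiv f) w = poly f w * (\<Sum>j=1..d. 1 / (w - \<zeta> j))"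
    unfolding assms(2) using w_ne by (intro poly_pderiv_prod_linear) auto
  moreover have w_sum: "w * (\<Sum>j=1..d. 1 / (w - \<zeta> j)) = (\<Sum>j=1..d. w / (w - \<zeta> j))"
    by (simp add: sum_distrib_left)
  \<comment> \<open>The factor \<i> comes from differentiating the exponential. Isolating it turns
    the imaginary part of the logarithmic derivative of the loop into the real part of the sum, to
    which the bounds apply termwise.\<close>
  ultimately have "2 * of_real pi * \<i> * w * poly (pderiv f) w / poly f w =
      of_real (2 * pi) * (\<i> * (\<Sum>j=1..d. w / (w - \<zeta> j)))"
    using nz by (simp add: flip: w_sum)
  then have "Im (2 * of_real pi * \<i> * w * poly (pderiv f) w / poly f w) = 2 * pi * ?S"
    by simp
  then have a': "(a has_real_derivative 2 * pi * ?S) (at t)"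
    using arg_branch_at_has_real_derivative[OF a circle_value_has_vector_derivative]
    by (simp add: val w_def)
  then show "a differentiable (at t)"
    using real_differentiable_def by blast
  have deriv: "deriv a t = 2 * pi * ?S"
    using a' by (rule DERIV_imp_deriv)
  have "(\<Sum>j=1..d. r / (r + 1)) \<le> ?S" "?S \<le> (\<Sum>j=1..d. r / (r - 1))"
    using assms(4) norm_w \<open>r > 1\<close> by (intro sum_mono Re_divide_diff_bounds; simp)+
  then have "real d * (r / (r + 1)) \<le> ?S" "?S \<le> real d * (r / (r - 1))"
    by simp_all
  then have "2 * pi * (real d * (r / (r + 1))) \<le> deriv a t" "deriv a t \<le> 2 * pi * (real d * (r / (r - 1)))"
    unfolding deriv by (intro mult_left_mono; simp)+
  then show "2 * pi * real d * (r / (r + 1)) \<le> deriv a t" "deriv a t \<le> 2 * pi * real d * (r / (r - 1))"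
    by (simp_all only: mult.assoc)
qed

end
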